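(* For every integer $n\ge 3$, $$\tau_4(C_n)=\begin{cases}15 & \text{if } n=5,\\ 14 & \text{if } n=4,\\ 13 & \text{if } n=7,\\ 12 & \text{otherwise.}\end{cases}$$
   Context: $C_n$ is the cycle on $n$ vertices. $[k]=\{1,\dots,k\}$ and $\binom{[k]}{t}$ is the collection of all $t$-element subsets of $[k]$. $d(v,w)$ is the distance between $v$ and $w$. For a finite simple graph $G$ and positive integers $t,k$, a $t$-tone $k$-coloring of $G$ is a function $f:V(G)\to\binom{[k]}{t}$ such that $|f(v)\cap f(w)|<d(v,w)$ for all distinct $v,w\in V(G)$. The $t$-tone chromatic number $\tau_t(G)$ is the minimum $k$ such that $G$ has a $t$-tone $k$-coloring. *)

theory Defs
  imports "Graph_Theory.Graph_Theory"
begin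

text \<open>
  A finite simple graph is a \<open>graph\<close> in the sense of \<open>Graph_Theory\<close>: a finite, symmetric,
  loop-free digraph without parallel arcs. An undirected edge is thus a pair of opposite arcs.
\<close>

context graph
begin

text \<open>The infimum over the empty set makes this infinite for vertices in different components.\<close>

definition distance :: "'a \<Rightarrow> 'a \<Rightarrow> ereal" where
  "distance v w = \<mu> (\<lambda>_. 1) v w"

definition tone_coloring :: "nat \<Rightarrow> nat \<Rightarrow> ('a \<Rightarrow> nat set) \<Rightarrow> bool" where
  "tone_coloring t k f \<longleftrightarrow>
     (\<forall>v\<in>verts G. f v \<subseteq> {1..k} \<and> card (f v) = t) \<and>
     (\<forall>v\<in>verts G. \<forall>w\<in>verts G. v \<noteq> w \<longrightarrow>
        ereal (real (card (f v \<inter> f w))) < distance v w)"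

definition tone_chromatic_number :: "nat \<Rightarrow> nat" where
  "tone_chromatic_number t = (LEAST k. 0 < k \<and> (\<exists>f. tone_coloring t k f))"

lemma distance_pos:
  assumes "v \<noteq> w"
  shows "0 < distance v w"
proof -
  have "1 \<le> ereal (awalk_cost (\<lambda>_. 1) p)" if "awalk v p w" for p
  proof -
    have "p \<noteq> []" using that assms by (auto simp: awalk_Nil_iff)
    moreover have "awalk_cost (\<lambda>_. 1) p = real (length p)"
      by (induction p) auto
    ultimately show ?thesis by (cases p) auto
  qed
  then have "1 \<le> distance v w"
    unfolding distance_def \<mu>_def by (auto intro: INF_greatest)
  then show ?thesis by (rule less_le_trans[rotated]) simp
qed

text \<open>The minimum in the definition of the \<open>t\<close>-tone chromatic number is attained.\<close>

lemma tone_coloring_exists: "\<exists>k>0. \<exists>f. tone_coloring t k f"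
proof -
  obtain g :: "'a \<Rightarrow> nat" where g: "inj_on g (verts G)" "g ` verts G = {..<card (verts G)}"
    using ex_bij_betw_finite_nat[OF finite_verts] unfolding bij_betw_def
    by (auto simp: atLeast0LessThan)
  define f where "f v = {t * g v + 1 .. t * g v + t}" for v
  define k where "k = Suc (t * card (verts G))"
  have "f v \<subseteq> {1..k}" if "v \<in> verts G" for v
  proof -
    have "g v \<in> {..<card (verts G)}" unfolding g(2)[symmetric] using that by (rule imageI)
    then have "Suc (g v) \<le> card (verts G)" by simp
    then have "t * Suc (g v) \<le> t * card (verts G)" by (rule mult_le_mono2)
    then show ?thesis unfolding f_def k_def by auto
  qed
  moreover have "card (f v) = t" for v by (simp add: f_def)
  moreover have "f v \<inter> f w = {}" if "v \<in> verts G" "w \<in> verts G" "v \<noteq> w" for v w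
  proof -
    have *: "{t * a + 1 .. t * a + t} \<inter> {t * b + 1 .. t * b + t} = {}" if "a < b" for a b
    proof -
      have "t * Suc a \<le> t * b" using that by (intro mult_le_mono2) simp
      then show ?thesis by auto
    qed
    have "g v \<noteq> g w" using g(1) that by (auto dest: inj_onD)
    then show ?thesis unfolding f_def
      using *[of "g v" "g w"] *[of "g w" "g v"] by (cases "g v < g w") auto
  qed
  ultimately have "tone_coloring t k f"
    unfolding tone_coloring_def by (simp add: distance_pos flip: zero_ereal_def)
  then show ?thesis unfolding k_def by blast
qed

lemma tone_chromatic_number_attained:
  "\<exists>f. tone_coloring t (tone_chromatic_number t) f"
proof -
  have "\<exists>k. 0 < k \<and> (\<exists>f. tone_coloring t k f)" using tone_coloring_exists by blast
  from LeastI_ex[OF this] show ?thesis unfolding tone_chromatic_number_def by blast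
qed

end

text \<open>The cycle on the vertices \<open>0, \<dots>, n - 1\<close>, intended for \<open>n \<ge> 3\<close>.\<close>

definition cycle_graph :: "nat \<Rightarrow> (nat, nat \<times> nat) pre_digraph" where
  "cycle_graph n = with_proj
     \<lparr> pverts = {..<n},
       parcs = {(i, j). i < n \<and> j < n \<and> (j = (i + 1) mod n \<or> i = (j + 1) mod n)} \<rparr>"

lemma graph_cycle_graph:
  assumes "n \<ge> 3"
  shows "graph (cycle_graph n)"
proof -
  define A where "A = {(i, j). i < n \<and> j < n \<and> (j = (i + 1) mod n \<or> i = (j + 1) mod n)}"
  have "finite A" by (rule finite_subset[of _ "{..<n} \<times> {..<n}"]) (auto simp: A_def)
  moreover have "i \<noteq> Suc i mod n" "Suc i mod n \<noteq> i" if "i < n" for i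
    using that assms by (cases "i + 1 = n"; auto)+
  ultimately have "pair_graph \<lparr> pverts = {..<n}, parcs = A \<rparr>"
    by unfold_locales (auto simp: A_def symmetric_def sym_def)
  then interpret pair_graph "\<lparr> pverts = {..<n}, parcs = A \<rparr>" .
  show ?thesis unfolding cycle_graph_def A_def[symmetric] by unfold_locales
qed

end

theory Submission
  imports Defs
begin

text \<open>
  On a cycle, the conditions on a \<open>t\<close>-tone coloring say that the color sets of any vertex and of
  the \<open>d\<close>-th vertex after it have fewer than \<open>d\<close> common colors, for \<open>0 < d < n\<close>. For
  \<open>t = 4\<close> only \<open>d \<le> 4\<close> matters, since four-element sets never have five common elements.

  Lower bounds. The three color sets on \<open>C\<^sub>3\<close> are disjoint. For \<open>n \<ge> 4\<close>, the union of four
  consecutive color sets has at least \<open>16 - (1 + 1 + 2) = 12\<close> elements by Bonferroni's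
  inequality. On \<open>C\<^sub>4\<close> the pair at distance \<open>3\<close> along the path is adjacent,
  which gives \<open>14\<close>, and on \<open>C\<^sub>5\<close> only five pairs of sets can meet, each in at most one color, which
  gives \<open>20 - 5 = 15\<close>. On \<open>C\<^sub>7\<close> a color is used at most three times, and a color used three
  times occurs on two pairs of vertices at distance \<open>2\<close>. As each of the seven such pairs has at
  most one common color, \<open>2 \<cdot> 28 \<le> 4 k + 7\<close>, hence \<open>k \<ge> 13\<close>.

  Upper bounds. Since the constraint is local, two cyclic words of color sets that satisfy it and
  agree in their first four letters can be concatenated. Words over twelve colors of lengths
  \<open>6, 8, 9, 10, 11, 13\<close> with the same first four letters therefore yield all lengths from
  \<open>6\<close> on except \<open>7\<close>: these lengths represent all residues modulo \<open>6\<close>, and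
  \<open>13\<close> is the first length in the residue class of \<open>7\<close> that is possible. The lengths
  \<open>3, 4, 5, 7\<close> have words of their own.
\<close>

section \<open>Tone colorings of cycles\<close>

lemma cycle_graph_simps [simp]:
  "verts (cycle_graph n) = {..<n}"
  "arcs (cycle_graph n) =
     {(i, j). i < n \<and> j < n \<and> (j = (i + 1) mod n \<or> i = (j + 1) mod n)}"
  "tail (cycle_graph n) = fst"
  "head (cycle_graph n) = snd"
  by (simp_all add: cycle_graph_def)

lemma (in wf_digraph) awalk_cost_one: "awalk_cost (\<lambda>_. 1) p = real (length p)"
  by (induction p) auto

lemma cycle_graph_awalk_forward:
  assumes "n \<ge> 3" "i < n"
  shows "\<exists>p. pre_digraph.awalk (cycle_graph n) i p ((i + d) mod n) \<and> length p = d"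
  using assms(2)
proof (induction d arbitrary: i)
  case 0
  interpret graph "cycle_graph n" by (rule graph_cycle_graph[OF assms(1)])
  from 0 show ?case by (simp add: awalk_Nil_iff)
next
  case (Suc d)
  interpret graph "cycle_graph n" by (rule graph_cycle_graph[OF assms(1)])
  have lt: "(i + 1) mod n < n" using assms(1) by simp
  obtain p where p: "awalk ((i + 1) mod n) p (((i + 1) mod n + d) mod n)" "length p = d"
    using Suc.IH[OF lt] by blast
  have "((i + 1) mod n + d) mod n = (i + Suc d) mod n"
    by (simp add: mod_simps)
  then have "awalk i ((i, (i + 1) mod n) # p) ((i + Suc d) mod n)"
    using p(1) Suc.prems lt by (simp add: awalk_Cons_iff)
  then show ?case using p(2) by (intro exI[of _ "(i, (i + 1) mod n) # p"]) simp
qed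

text \<open>The integer \<open>s\<close> is the number of forward steps minus the number of backward steps.\<close>

lemma cycle_graph_awalk_displacement:
  assumes "n \<ge> 3" "pre_digraph.awalk (cycle_graph n) v p w"
  shows "\<exists>s. \<bar>s\<bar> \<le> int (length p) \<and> int w = (int v + s) mod int n"
  using assms(2)
proof (induction p arbitrary: v)
  case Nil
  interpret graph "cycle_graph n" by (rule graph_cycle_graph[OF assms(1)])
  from Nil show ?case by (intro exI[of _ 0]) (simp add: awalk_Nil_iff)
next
  case (Cons e p)
  interpret graph "cycle_graph n" by (rule graph_cycle_graph[OF assms(1)])
  obtain u where e: "e = (v, u)" and u: "u < n" "v < n" "u = (v + 1) mod n \<or> v = (u + 1) mod n"
    and walk: "awalk u p w"
    using Cons.prems by (cases e) (auto simp: awalk_Cons_iff)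
  obtain s where s: "\<bar>s\<bar> \<le> int (length p)" "int w = (int u + s) mod int n"
    using Cons.IH[OF walk] by blast
  from u(3) show ?case
  proof
    assume "u = (v + 1) mod n"
    then have "int u = (int v + 1) mod int n" by (simp add: zmod_int add_ac)
    then have "int w = (int v + (1 + s)) mod int n" using s(2) by (simp add: mod_simps add_ac)
    then show ?thesis using s(1) by (intro exI[of _ "1 + s"]) simp
  next
    assume "v = (u + 1) mod n"
    then have "int v = (int u + 1) mod int n" by (simp add: zmod_int add_ac)
    then have "(int v + (s - 1)) mod int n = (int u + 1 + (s - 1)) mod int n"
      by (simp only: mod_add_left_eq)
    then have "int w = (int v + (s - 1)) mod int n" using s(2) by simp
    then show ?thesis using s(1) by (intro exI[of _ "s - 1"]) simp
  qed
qed

text \<open>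
  A pair of vertices is compared twice here, once in each direction around the cycle; the smaller
  of the two values of \<open>d\<close> is the distance.
\<close>

lemma tone_coloring_cycle_graph_iff:
  assumes "n \<ge> 3"
  shows "graph.tone_coloring (cycle_graph n) t k f \<longleftrightarrow>
    (\<forall>i<n. f i \<subseteq> {1..k} \<and> card (f i) = t) \<and>
    (\<forall>i<n. \<forall>d. 0 < d \<longrightarrow> d < n \<longrightarrow> card (f i \<inter> f ((i + d) mod n)) < d)"
    (is "?L \<longleftrightarrow> ?sets \<and> ?overlaps")
proof -
  interpret graph "cycle_graph n" by (rule graph_cycle_graph[OF assms])
  have "?overlaps" if "?L"
  proof (intro allI impI)
    fix i d assume i: "i < n" and d: "0 < d" "d < n"
    obtain p where p: "awalk i p ((i + d) mod n)" "length p = d"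
      using cycle_graph_awalk_forward[OF assms i] by blast
    have "distance i ((i + d) mod n) \<le> ereal (real d)"
      using min_cost_le_walk_cost[OF p(1), of "\<lambda>_. 1"] p(2)
      by (simp add: distance_def awalk_cost_one)
    moreover have "i \<noteq> (i + d) mod n"
      using i d by (auto simp: mod_if)
    then have "ereal (real (card (f i \<inter> f ((i + d) mod n)))) < distance i ((i + d) mod n)"
      using that i assms unfolding tone_coloring_def by simp
    ultimately have "ereal (real (card (f i \<inter> f ((i + d) mod n)))) < ereal (real d)"
      by (rule less_le_trans[rotated])
    then show "card (f i \<inter> f ((i + d) mod n)) < d" by simp
  qed
  moreover have "ereal (real (card (f v \<inter> f w))) < distance v w"
    if ov: "?overlaps" and v: "v < n" and w: "w < n" and "v \<noteq> w" for v w
  proof -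
    \<comment> \<open>Full turns around the cycle only make a walk longer, so \<open>s\<close> may be reduced modulo \<open>n\<close>.\<close>
    have forward: "card (f a \<inter> f b) < l"
      if "a < n" "a \<noteq> b" "b < n" "int b = (int a + int s) mod int n" "s \<le> l" for a b s l
    proof -
      define d where "d = s mod n"
      have "int b = int ((a + s) mod n)" using that(4) by (simp add: zmod_int)
      then have b: "b = (a + d) mod n" unfolding d_def by (simp add: mod_simps)
      have "d \<noteq> 0" using b that(1,2) by (intro notI) simp
      moreover have "d < n" unfolding d_def using assms by simp
      ultimately have "card (f a \<inter> f b) < d" using ov that(1) b by simp
      also have "d \<le> l" unfolding d_def using that(5) mod_less_eq_dividend[of s n] by linarith
      finally show ?thesis .
    qed
    have "card (f v \<inter> f w) < length p" if walk: "awalk v p w" for p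
    proof -
      obtain s where s: "\<bar>s\<bar> \<le> int (length p)" "int w = (int v + s) mod int n"
        using cycle_graph_awalk_displacement[OF assms walk] by blast
      show ?thesis
      proof (cases "s \<ge> 0")
        case True
        then show ?thesis
          using forward[of v w "nat s" "length p"] v w \<open>v \<noteq> w\<close> s by simp
      next
        case False
        have "int v = (int w + (- s)) mod int n"
          unfolding s(2) using v by (simp add: mod_simps)
        then show ?thesis
          using forward[of w v "nat (- s)" "length p"] v w \<open>v \<noteq> w\<close> s(1) False
          by (simp add: Int_commute)
      qed
    qed
    then have "ereal (real (card (f v \<inter> f w) + 1)) \<le> distance v w"
      unfolding distance_def \<mu>_def
      by (intro INF_greatest) (simp add: awalk_cost_one Suc_le_eq del: of_nat_Suc of_nat_add)
    moreover have "ereal (real (card (f v \<inter> f w))) < ereal (real (card (f v \<inter> f w) + 1))"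
      by simp
    ultimately show ?thesis by (rule less_le_trans[rotated])
  qed
  ultimately show ?thesis unfolding tone_coloring_def by auto
qed

lemma (in graph) tone_chromatic_number_eqI:
  assumes "0 < k" "tone_coloring t k f" "\<And>k' f'. tone_coloring t k' f' \<Longrightarrow> k \<le> k'"
  shows "tone_chromatic_number t = k"
  unfolding tone_chromatic_number_def by (rule Least_equality) (use assms in blast)+

section \<open>Lower bounds\<close>

text \<open>Bonferroni's inequality, with the subtracted terms moved to the other side.\<close>

lemma bonferroni:
  fixes A :: "nat \<Rightarrow> 'a set"
  assumes "\<And>i. i < m \<Longrightarrow> finite (A i)"
  shows "(\<Sum>i<m. card (A i)) \<le> card (\<Union>i<m. A i) + (\<Sum>j<m. \<Sum>i<j. card (A i \<inter> A j))"
  using assms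
proof (induction m)
  case 0
  then show ?case by simp
next
  case (Suc m)
  let ?U = "\<Union>i<m. A i"
  have fin: "finite ?U" "finite (A m)" using Suc.prems by auto
  have "?U \<inter> A m = (\<Union>i<m. A i \<inter> A m)" by auto
  then have "card (?U \<inter> A m) \<le> (\<Sum>i<m. card (A i \<inter> A m))"
    using card_UN_le[of "{..<m}" "\<lambda>i. A i \<inter> A m"] by simp
  moreover have "card ?U + card (A m) = card (?U \<union> A m) + card (?U \<inter> A m)"
    using fin by (rule card_Un_Int)
  moreover have "(\<Union>i<Suc m. A i) = ?U \<union> A m" by (auto simp: less_Suc_eq)
  moreover have "(\<Sum>i<m. card (A i)) \<le> card ?U + (\<Sum>j<m. \<Sum>i<j. card (A i \<inter> A j))"
    using Suc by simp
  ultimately show ?case by simp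
qed

context
  fixes n k :: nat and f :: "nat \<Rightarrow> nat set"
  assumes n: "n \<ge> 3" and coloring: "graph.tone_coloring (cycle_graph n) 4 k f"
begin

lemma color_sets: "i < n \<Longrightarrow> f i \<subseteq> {1..k}" "i < n \<Longrightarrow> card (f i) = 4"
  and color_overlap: "i < n \<Longrightarrow> 0 < d \<Longrightarrow> d < n \<Longrightarrow> card (f i \<inter> f ((i + d) mod n)) < d"
  using coloring unfolding tone_coloring_cycle_graph_iff[OF n] by blast+

text \<open>The bound is the distance of \<open>i\<close> and \<open>j\<close> on the cycle, minus one.\<close>

lemma color_overlap_le:
  assumes "i < j" "j < n"
  shows "card (f i \<inter> f j) \<le> min (j - i) (n - (j - i)) - 1"
proof -
  have "card (f i \<inter> f j) < j - i"
    using color_overlap[of i "j - i"] assms by simp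
  moreover have "(j + (n - (j - i))) mod n = i"
    using assms by (simp add: mod_if)
  then have "card (f i \<inter> f j) < n - (j - i)"
    using color_overlap[of j "n - (j - i)"] assms by (simp add: Int_commute)
  ultimately show ?thesis by linarith
qed

lemma bonferroni_colors:
  assumes "m \<le> n"
  shows "4 * m \<le> k + (\<Sum>j<m. \<Sum>i<j. min (j - i) (n - (j - i)) - 1)"
proof -
  have "card (\<Union>i<m. f i) \<le> card {1..k}"
    using color_sets(1) assms by (intro card_mono UN_least) simp_all
  moreover have "(\<Sum>i<m. card (f i)) = 4 * m"
    using color_sets(2) assms by simp
  moreover have "finite (f i)" if "i < m" for i
    using color_sets(2)[of i] that assms by (intro card_ge_0_finite) simp
  moreover have "(\<Sum>j<m. \<Sum>i<j. card (f i \<inter> f j))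
      \<le> (\<Sum>j<m. \<Sum>i<j. min (j - i) (n - (j - i)) - 1)"
    using assms by (intro sum_mono color_overlap_le) auto
  ultimately show ?thesis using bonferroni[of m f] by simp
qed

lemma colors_ge_12: "12 \<le> k"
proof (cases "n = 3")
  case True
  have "(\<Sum>j<3. \<Sum>i<j. min (j - i) (3 - (j - i)) - 1) = (0::nat)" by code_simp
  then show ?thesis using bonferroni_colors[of 3] True by simp
next
  case False
  have "(\<Sum>j<4. \<Sum>i<j. min (j - i) (n - (j - i)) - 1) \<le> (\<Sum>j<4. \<Sum>i<j. j - i - 1)"
    by (intro sum_mono diff_le_mono) simp
  also have "\<dots> = (4::nat)" by code_simp
  finally show ?thesis using bonferroni_colors[of 4] n False by simp
qed

lemma colors_ge_14:
  assumes "n = 4"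
  shows "14 \<le> k"
proof -
  have "(\<Sum>j<4. \<Sum>i<j. min (j - i) (4 - (j - i)) - 1) = (2::nat)" by code_simp
  then show ?thesis using bonferroni_colors[of 4] assms by simp
qed

lemma colors_ge_15:
  assumes "n = 5"
  shows "15 \<le> k"
proof -
  have "(\<Sum>j<5. \<Sum>i<j. min (j - i) (5 - (j - i)) - 1) = (5::nat)" by code_simp
  then show ?thesis using bonferroni_colors[of 5] assms by simp
qed

text \<open>
  Each color is counted with the weight \<open>2 s - e\<close>, where \<open>s\<close> is the number of vertices that have
  it and \<open>e\<close> the number of pairs at distance \<open>2\<close> that share it. This weight is at most \<open>4\<close>:
  either \<open>s \<le> 2\<close>, or the color class is an independent set of size three, and then \<open>e = 2\<close>.
\<close>

lemma colors_ge_13: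
  assumes "n = 7"
  shows "13 \<le> k"
proof -
  let ?x = "\<lambda>i c. of_bool (c \<in> f i) :: nat"
  let ?y = "\<lambda>i c. of_bool (c \<in> f i \<inter> f ((i + 2) mod 7)) :: nat"
  have count: "(\<Sum>c\<in>{1..k}. of_bool (c \<in> A)) = card A" if "A \<subseteq> {1..k}" for A
    using that by (simp add: of_bool_def sum.If_cases Int_absorb1)
  have weight: "2 * (\<Sum>i<7. ?x i c) \<le> 4 + (\<Sum>i<7. ?y i c)" for c
  proof -
    have disjoint: "\<not> (c \<in> f i \<and> c \<in> f j)" if "i < 7" "j = (i + 1) mod 7" for i j
      using color_overlap[of i 1] color_sets[of i] that assms
      by (auto simp: card_eq_0_iff intro: finite_subset)
    have "(\<Sum>i<7. ?x i c) = ?x 0 c + ?x 1 c + ?x 2 c + ?x 3 c + ?x 4 c + ?x 5 c + ?x 6 c"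
      by (simp add: lessThan_nat_numeral lessThan_Suc numeral_2_eq_2 del: sum_of_bool_eq)
    moreover have "(\<Sum>i<7. ?y i c) = of_bool (c \<in> f 0 \<and> c \<in> f 2) + of_bool (c \<in> f 1 \<and> c \<in> f 3)
        + of_bool (c \<in> f 2 \<and> c \<in> f 4) + of_bool (c \<in> f 3 \<and> c \<in> f 5)
        + of_bool (c \<in> f 4 \<and> c \<in> f 6) + of_bool (c \<in> f 5 \<and> c \<in> f 0)
        + of_bool (c \<in> f 6 \<and> c \<in> f 1)"
      by (simp add: lessThan_nat_numeral lessThan_Suc numeral_2_eq_2 del: sum_of_bool_eq)
    moreover have "\<not> (c \<in> f 0 \<and> c \<in> f 1)" "\<not> (c \<in> f 1 \<and> c \<in> f 2)"
      "\<not> (c \<in> f 2 \<and> c \<in> f 3)" "\<not> (c \<in> f 3 \<and> c \<in> f 4)" "\<not> (c \<in> f 4 \<and> c \<in> f 5)"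
      "\<not> (c \<in> f 5 \<and> c \<in> f 6)" "\<not> (c \<in> f 6 \<and> c \<in> f 0)"
      by (rule disjoint; simp)+
    ultimately show ?thesis
      by (cases "c \<in> f 0"; cases "c \<in> f 1"; cases "c \<in> f 2"; cases "c \<in> f 3";
          cases "c \<in> f 4"; cases "c \<in> f 5"; cases "c \<in> f 6") simp_all
  qed
  have "2 * (\<Sum>i<7. card (f i)) = 2 * (\<Sum>i<7. \<Sum>c\<in>{1..k}. ?x i c)"
    using color_sets(1) assms by (intro arg_cong[of _ _ "\<lambda>x. 2 * x"] sum.cong refl count[symmetric]) simp
  also have "\<dots> = (\<Sum>c\<in>{1..k}. 2 * (\<Sum>i<7. ?x i c))"
    by (subst sum.swap) (rule sum_distrib_left)
  also have "\<dots> \<le> (\<Sum>c\<in>{1..k}. 4 + (\<Sum>i<7. ?y i c))"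
    by (rule sum_mono) (rule weight)
  also have "\<dots> = 4 * k + (\<Sum>i<7. \<Sum>c\<in>{1..k}. ?y i c)"
    by (subst sum.swap) (simp add: sum.distrib)
  also have "(\<Sum>i<7. \<Sum>c\<in>{1..k}. ?y i c) = (\<Sum>i<7. card (f i \<inter> f ((i + 2) mod 7)))"
    using color_sets assms by (intro sum.cong refl count) auto
  also have "\<dots> \<le> (\<Sum>i<7::nat. 1)"
    using color_overlap[of _ 2] assms by (intro sum_mono) (simp add: less_Suc_eq_le numeral_2_eq_2)
  finally show ?thesis using color_sets(2) assms by simp
qed

end

section \<open>Cyclic words of color sets\<close>

text \<open>
  A list of color sets is read cyclically: the last entry is followed by the first one. The guard
  \<open>d < length w\<close> keeps an entry from being compared with itself in words of length at most \<open>4\<close>.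
\<close>

definition tone_word :: "nat \<Rightarrow> nat set list \<Rightarrow> bool" where
  "tone_word k w \<longleftrightarrow>
     (\<forall>A\<in>set w. A \<subseteq> {1..k} \<and> card A = 4) \<and>
     (\<forall>i<length w. \<forall>d\<in>{1..4}.
        d < length w \<longrightarrow> card (w ! i \<inter> w ! ((i + d) mod length w)) < d)"

lemma tone_wordD:
  assumes "tone_word k w"
  shows "A \<in> set w \<Longrightarrow> A \<subseteq> {1..k}" "A \<in> set w \<Longrightarrow> card A = 4"
    and "\<lbrakk>i < length w; 0 < d; d \<le> 4; d < length w\<rbrakk>
      \<Longrightarrow> card (w ! i \<inter> w ! ((i + d) mod length w)) < d"
  using assms unfolding tone_word_def by auto

lemma tone_coloring_of_tone_word:
  assumes "tone_word k w" "length w = n" "n \<ge> 3"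
  shows "graph.tone_coloring (cycle_graph n) 4 k ((!) w)"
proof -
  have sets: "w ! i \<subseteq> {1..k}" "card (w ! i) = 4" if "i < n" for i
    using tone_wordD(1,2)[OF assms(1)] assms(2) that by simp_all
  have "card (w ! i \<inter> w ! ((i + d) mod n)) < d" if "i < n" "0 < d" "d < n" for i d
  proof (cases "d \<le> 4")
    case True
    then show ?thesis using tone_wordD(3)[OF assms(1)] assms(2) that by simp
  next
    case False
    have "finite (w ! i)" using sets(2)[OF that(1)] by (intro card_ge_0_finite) simp
    then have "card (w ! i \<inter> w ! ((i + d) mod n)) \<le> card (w ! i)"
      by (rule card_mono) simp
    then show ?thesis using sets(2)[OF that(1)] False by simp
  qed
  then show ?thesis unfolding tone_coloring_cycle_graph_iff[OF assms(3)] using sets by blast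
qed

text \<open>
  Comparisons reach at most four letters ahead, and the four letters that follow the end of either
  word in the concatenation are those that follow it when the word is closed up on its own.
\<close>

lemma tone_word_append:
  assumes u: "tone_word k u" "length u \<ge> 5" and w: "tone_word k w" "length w \<ge> 5"
    and prefix: "take 4 u = take 4 w"
  shows "tone_word k (u @ w)"
proof -
  let ?a = "length u" and ?b = "length w"
  have same: "u ! j = w ! j" if "j < 4" for j
    using prefix that by (metis nth_take)
  have overlaps: "card ((u @ w) ! i \<inter> (u @ w) ! ((i + d) mod (?a + ?b))) < d"
    if i: "i < ?a + ?b" and d: "1 \<le> d" "d \<le> 4" for i d
  proof (cases "i < ?a")
    case True
    have "(u @ w) ! ((i + d) mod (?a + ?b)) = u ! ((i + d) mod ?a)"
    proof (cases "i + d < ?a")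
      case False
      have "(i + d) mod (?a + ?b) = i + d"
        using True d w(2) by simp
      moreover have "(i + d) mod ?a = i + d - ?a"
        using True False d u(2) by (simp add: mod_if[of "i + d"])
      moreover have "u ! (i + d - ?a) = w ! (i + d - ?a)"
        using True False d by (intro same) simp
      ultimately show ?thesis using False by (simp add: nth_append)
    qed (simp add: nth_append)
    moreover have "card (u ! i \<inter> u ! ((i + d) mod ?a)) < d"
      using tone_wordD(3)[OF u(1)] u(2) True d by simp
    ultimately show ?thesis using True by (simp add: nth_append)
  next
    case False
    define j where "j = i - ?a"
    have j: "i = ?a + j" "j < ?b" using False i unfolding j_def by auto
    have "(u @ w) ! ((i + d) mod (?a + ?b)) = w ! ((j + d) mod ?b)"
    proof (cases "j + d < ?b")
      case False
      have "i + d = (j + d - ?b) + (?a + ?b)" using False j(1) by simp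
      moreover have lt: "j + d - ?b < ?a" using j(2) d u(2) by simp
      then have "j + d - ?b < ?a + ?b" by simp
      ultimately have "(i + d) mod (?a + ?b) = j + d - ?b"
        by (simp only: mod_add_self2 mod_less)
      moreover have "(j + d) mod ?b = j + d - ?b"
        using False j d w(2) by (simp add: mod_if[of "j + d"])
      moreover have "u ! (j + d - ?b) = w ! (j + d - ?b)"
        using False j d by (intro same) simp
      ultimately show ?thesis using lt by (simp add: nth_append)
    qed (simp add: j nth_append)
    moreover have "card (w ! j \<inter> w ! ((j + d) mod ?b)) < d"
      using tone_wordD(3)[OF w(1)] w(2) j d by simp
    ultimately show ?thesis using j by (simp add: nth_append)
  qed
  have letters: "A \<subseteq> {1..k} \<and> card A = 4" if "A \<in> set (u @ w)" for A
    using tone_wordD(1,2)[OF u(1)] tone_wordD(1,2)[OF w(1)] that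
    unfolding set_append by blast
  show ?thesis
    unfolding tone_word_def
  proof (intro conjI ballI allI impI)
    fix i d :: nat assume "i < length (u @ w)" "d \<in> {1..4}"
    then show "card ((u @ w) ! i \<inter> (u @ w) ! ((i + d) mod length (u @ w))) < d"
      using overlaps[of i d] by simp
  qed (use letters in blast)+
qed

text \<open>A form of the definition in which the length is a numeral and the conditions are finite
  conjunctions.\<close>

lemma tone_wordI:
  assumes "length w = n" "\<forall>A\<in>set w. A \<subseteq> {1..k} \<and> card A = 4"
    "\<forall>i\<in>{..<n}. \<forall>d\<in>{1, 2, 3, 4}. d < n \<longrightarrow> card (w ! i \<inter> w ! ((i + d) mod n)) < d"
  shows "tone_word k w"
proof -
  have "{1..4} = {1, 2, 3, 4::nat}" by auto
  then show ?thesis using assms unfolding tone_word_def by simp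
qed

lemma tone_word_3: "tone_word 12 [{1,2,3,4}, {5,6,7,8}, {9,10,11,12}]"
  by (rule tone_wordI[where n = 3]) (simp_all add: lessThan_nat_numeral)

lemma tone_word_4: "tone_word 14 [{1,2,3,4}, {5,6,7,8}, {1,9,10,11}, {5,12,13,14}]"
  by (rule tone_wordI[where n = 4]) (simp_all add: lessThan_nat_numeral)

lemma tone_word_5:
  "tone_word 15 [{1,4,6,7}, {2,5,8,9}, {1,3,10,11}, {2,4,12,13}, {3,5,14,15}]"
  by (rule tone_wordI[where n = 5]) (simp_all add: lessThan_nat_numeral)

lemma tone_word_6:
  "tone_word 12 [{1,2,3,4}, {5,6,7,8}, {1,9,10,11}, {2,3,5,12}, {4,7,8,11}, {6,9,10,12}]"
  by (rule tone_wordI[where n = 6]) (simp_all add: lessThan_nat_numeral)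

lemma tone_word_7:
  "tone_word 13 [{1,2,3,4}, {5,6,7,8}, {1,9,10,11}, {2,3,5,12}, {1,6,8,13}, {4,7,10,11},
     {5,9,12,13}]"
  by (rule tone_wordI[where n = 7]) (simp_all add: lessThan_nat_numeral)

lemma tone_word_8:
  "tone_word 12 [{1,2,3,4}, {5,6,7,8}, {1,9,10,11}, {2,3,5,12}, {4,6,8,10}, {1,3,7,9},
     {2,5,8,11}, {6,9,10,12}]"
  by (rule tone_wordI[where n = 8]) (simp_all add: lessThan_nat_numeral)

lemma tone_word_9:
  "tone_word 12 [{1,2,3,4}, {5,6,7,8}, {1,9,10,11}, {2,3,5,12}, {4,6,8,10}, {2,7,9,11},
     {1,4,5,12}, {3,6,7,10}, {8,9,11,12}]"
  by (rule tone_wordI[where n = 9]) (simp_all add: lessThan_nat_numeral)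

lemma tone_word_10:
  "tone_word 12 [{1,2,3,4}, {5,6,7,8}, {1,9,10,11}, {2,3,5,12}, {4,7,8,11}, {1,5,6,10},
     {3,4,9,12}, {1,2,7,11}, {3,6,8,10}, {5,9,11,12}]"
  by (rule tone_wordI[where n = 10]) (simp_all add: lessThan_nat_numeral)

lemma tone_word_11:
  "tone_word 12 [{1,2,3,4}, {5,6,7,8}, {1,9,10,11}, {2,3,5,12}, {4,6,7,9}, {1,5,8,11},
     {3,7,10,12}, {2,4,8,9}, {1,3,6,11}, {4,5,7,10}, {8,9,11,12}]"
  by (rule tone_wordI[where n = 11]) (simp_all add: lessThan_nat_numeral)

lemma tone_word_13:
  "tone_word 12 [{1,2,3,4}, {5,6,7,8}, {1,9,10,11}, {2,3,5,12}, {1,4,6,8}, {2,7,9,10},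
     {1,5,11,12}, {3,4,8,9}, {2,6,10,11}, {4,5,7,12}, {1,3,8,10}, {2,5,6,9}, {7,10,11,12}]"
  by (rule tone_wordI[where n = 13]) (simp_all add: lessThan_nat_numeral)

text \<open>Prepending the word of length \<open>6\<close> turns a word of length \<open>n - 6\<close> into one of length \<open>n\<close>.\<close>

lemma exists_tone_word:
  assumes "n \<ge> 6" "n \<noteq> 7"
  shows "\<exists>w. tone_word 12 w \<and> length w = n \<and>
    take 4 w = [{1,2,3,4}, {5,6,7,8}, {1,9,10,11}, {2,3,5,12}]"
  using assms
proof (induction n rule: less_induct)
  case (less n)
  consider "n = 6" | "n = 8" | "n = 9" | "n = 10" | "n = 11" | "n = 13" | "n - 6 \<ge> 6" "n - 6 \<noteq> 7"
    using less.prems by linarith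
  then show ?case
  proof cases
    case 7
    then obtain w where w: "tone_word 12 w" "length w = n - 6"
        "take 4 w = [{1,2,3,4}, {5,6,7,8}, {1,9,10,11}, {2,3,5,12}]"
      using less.IH[of "n - 6"] less.prems by auto
    let ?h = "[{1,2,3,4}, {5,6,7,8}, {1,9,10,11}, {2,3,5,12}, {4,7,8,11}, {6,9,10,12}]"
    have "tone_word 12 (?h @ w)"
      by (rule tone_word_append[OF tone_word_6 _ w(1)]) (use w(2,3) 7 in simp_all)
    then show ?thesis
      using w(2) 7 by (intro exI[of _ "?h @ w"]) simp
  qed (use tone_word_6 tone_word_8 tone_word_9 tone_word_10 tone_word_11 tone_word_13 in
        fastforce)+
qed

section \<open>The 4-tone chromatic number of a cycle\<close>

theorem theorem4p3:
  fixes n :: nat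
  assumes "n \<ge> 3"
  shows "graph.tone_chromatic_number (cycle_graph n) 4 =
    (if n = 5 then 15 else if n = 4 then 14 else if n = 7 then 13 else 12)"
proof -
  let ?k = "if n = 5 then 15 else if n = 4 then 14 else if n = 7 then 13 else 12 :: nat"
  interpret graph "cycle_graph n" by (rule graph_cycle_graph[OF assms])
  obtain w where w: "tone_word ?k w" "length w = n"
  proof -
    consider "n = 3" | "n = 4" | "n = 5" | "n = 7" | "n \<ge> 6" "n \<noteq> 7"
      using assms by linarith
    then show ?thesis
    proof cases
      case 1 then show ?thesis using tone_word_3 that by fastforce
    next
      case 2 then show ?thesis using tone_word_4 that by fastforce
    next
      case 3 then show ?thesis using tone_word_5 that by fastforce
    next
      case 4 then show ?thesis using tone_word_7 that by fastforce
    next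
      case 5 then show ?thesis using exists_tone_word[of n] that by auto
    qed
  qed
  show ?thesis
  proof (rule tone_chromatic_number_eqI)
    show "tone_coloring 4 ?k ((!) w)" using tone_coloring_of_tone_word[OF w assms] .
    show "?k \<le> k'" if "tone_coloring 4 k' f'" for k' f'
      using colors_ge_12[OF assms that] colors_ge_13[OF assms that]
        colors_ge_14[OF assms that] colors_ge_15[OF assms that] by simp
  qed simp
qed

end
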